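(* Let $V$ be a finite-dimensional real inner product space, let $g\colon V\to(-\infty,+\infty]$ be a proper convex lower semicontinuous function, and let $F\colon \operatorname{dom} g\to V$ be monotone, i.e. $\langle F(u)-F(v),u-v\rangle\ge 0$ for all $u,v\in\operatorname{dom} g$, and $L$-Lipschitz. Assume that the solution set $S$ of the variational inequality $$\text{find } z^*\in V \text{ such that } \langle F(z^* ),z-z^*\rangle+g(z)-g(z^* )\ge 0\quad \forall z\in V$$ is nonempty. For $\lambda>0$ and $z\in\operatorname{dom} g$ let $r(z,\lambda)=z-\operatorname{prox}_{\lambda g}(z-\lambda F(z))$, and assume that the following error bound holds for some fixed $\lambda>0$: there exist constants $\mu>0$ and $\eta>0$ such that $$\operatorname{dist}(z,S)\le\mu\|r(z,\lambda)\|\qquad\text{for all } z\in\operatorname{dom} g \text{ with } \|r(z,\lambda)\|\le\eta.$$ Then the sequence $(z^k)$ generated by the modified adaptive Golden Ratio Algorithm with parameter $\delta\in(0,1)$ (described in the context) converges to a solution of the variational inequality at least $R$-linearly.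
   Context: $\|\cdot\|=\sqrt{\langle\cdot,\cdot\rangle}$; $\operatorname{dom} g=\{x\in V: g(x)<+\infty\}$; for $\lambda>0$, $\operatorname{prox}_{\lambda g}(z)=\operatorname{argmin}_{x\in V}\{\lambda g(x)+\frac12\|x-z\|^2\}$; $\operatorname{dist}(z,S)$ is the distance from $z$ to $S$. Solutions $z^*$ of the variational inequality are understood to lie in $\operatorname{dom} g$. Modified adaptive Golden Ratio Algorithm. Let $\varphi=\frac{\sqrt5+1}{2}$. Input: $z^0,z^1\in\operatorname{dom} g$, $\lambda_0>0$, $\phi\in(1,\varphi]$, $\bar\lambda>0$, $\delta\in(0,1)$. Set $\bar z^0=z^1$, $\theta_0=1$, $\rho=\frac1\phi+\frac1{\phi^2}$. For $k\ge1$: 1. $\displaystyle \lambda_k=\min\Bigl\{\rho\lambda_{k-1},\ \frac{\phi\,\delta\,\theta_{k-1}}{4\lambda_{k-1}}\frac{\|z^k-z^{k-1}\|^2}{\|F(z^k)-F(z^{k-1})\|^2},\ \bar\lambda\Bigr\}$, where a quotient with zero denominator (including $\frac00$) is taken to be $+\infty$; 2. $\displaystyle \bar z^k=\frac{(\phi-1)z^k+\bar z^{k-1}}{\phi}$, $\quad z^{k+1}=\operatorname{prox}_{\lambda_k g}(\bar z^k-\lambda_kF(z^k))$; 3. $\displaystyle \theta_k=\phi\,\frac{\lambda_k}{\lambda_{k-1}}$. Rates. A sequence $(u^k)$ converging to $u$ converges $Q$-linearly if there is $q\in(0,1)$ such that $\|u^{k+1}-u\|<q\|u^k-u\|$ for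 all $k$ large enough. It converges $R$-linearly if for all $k$ large enough $\|u^k-u\|\le\gamma_k$, where $(\gamma_k)$ is a real sequence converging $Q$-linearly to zero. *)

theory Defs
  imports "HOL-Analysis.Analysis"
begin

definition effdom :: "('a \<Rightarrow> ereal) \<Rightarrow> 'a set" where
  "effdom g = {x. g x < \<infinity>}"

definition proper_fun :: "('a \<Rightarrow> ereal) \<Rightarrow> bool" where
  "proper_fun g \<longleftrightarrow> (\<forall>x. g x \<noteq> -\<infinity>) \<and> effdom g \<noteq> {}"

(* For a proper g no sum below is of the form \<infinity> - \<infinity>; in ereal, 0 * \<infinity> = 0. *)
definition convex_fun :: "('a::real_vector \<Rightarrow> ereal) \<Rightarrow> bool" where
  "convex_fun g \<longleftrightarrow> (\<forall>x y. \<forall>u\<ge>0. \<forall>v\<ge>0. u + v = 1 \<longrightarrow>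
     g (u *\<^sub>R x + v *\<^sub>R y) \<le> ereal u * g x + ereal v * g y)"

definition lsc_fun :: "('a::topological_space \<Rightarrow> ereal) \<Rightarrow> bool" where
  "lsc_fun g \<longleftrightarrow> (\<forall>x. g x \<le> Liminf (at x) g)"

definition monotone_operator_on :: "'a::real_inner set \<Rightarrow> ('a \<Rightarrow> 'a) \<Rightarrow> bool" where
  "monotone_operator_on D F \<longleftrightarrow> (\<forall>u\<in>D. \<forall>v\<in>D. (F u - F v) \<bullet> (u - v) \<ge> 0)"

(* arg_min picks some minimizer; for proper convex lsc g on a Euclidean space and \<tau> > 0
   the minimizer exists and is unique. *)
definition prox :: "real \<Rightarrow> ('a::real_inner \<Rightarrow> ereal) \<Rightarrow> 'a \<Rightarrow> 'a" where
  "prox \<tau> g z = (ARG_MIN (\<lambda>x. ereal \<tau> * g x + ereal (1/2 * (norm (x - z))\<^sup>2)) x. True)"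

definition VI_solutions :: "('a::real_inner \<Rightarrow> ereal) \<Rightarrow> ('a \<Rightarrow> 'a) \<Rightarrow> 'a set" where
  "VI_solutions g F =
     {zs \<in> effdom g. \<forall>z. ereal (F zs \<bullet> (z - zs)) + g z - g zs \<ge> 0}"

definition residual :: "('a::real_inner \<Rightarrow> ereal) \<Rightarrow> ('a \<Rightarrow> 'a) \<Rightarrow> 'a \<Rightarrow> real \<Rightarrow> 'a" where
  "residual g F z \<tau> = z - prox \<tau> g (z - \<tau> *\<^sub>R F z)"

definition error_bound :: "('a::euclidean_space \<Rightarrow> ereal) \<Rightarrow> ('a \<Rightarrow> 'a) \<Rightarrow> real \<Rightarrow> bool" where
  "error_bound g F \<tau> \<longleftrightarrow> (\<exists>\<mu>>0. \<exists>\<eta>>0. \<forall>z\<in>effdom g.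
     norm (residual g F z \<tau>) \<le> \<eta> \<longrightarrow>
     infdist z (VI_solutions g F) \<le> \<mu> * norm (residual g F z \<tau>))"

definition golden_ratio :: real where
  "golden_ratio = (sqrt 5 + 1) / 2"

(* Every quotient with zero denominator is \<infinity>, including 0/0 (for which ereal division gives 0). *)
definition quot_infty :: "real \<Rightarrow> real \<Rightarrow> ereal" where
  "quot_infty a b = (if b = 0 then \<infinity> else ereal (a / b))"

(* The iterates z, z-bar and the step data lam, \<theta> of a run of the algorithm. The minimum of
   three extended reals is finite because lam_max is. *)
definition adaptive_graal ::
  "('a::real_inner \<Rightarrow> ereal) \<Rightarrow> ('a \<Rightarrow> 'a) \<Rightarrow> real \<Rightarrow> real \<Rightarrow> real \<Rightarrow>
   (nat \<Rightarrow> 'a) \<Rightarrow> (nat \<Rightarrow> 'a) \<Rightarrow> (nat \<Rightarrow> real) \<Rightarrow> (nat \<Rightarrow> real) \<Rightarrow> bool" where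
  "adaptive_graal g F \<phi> \<delta> lam_max z zbar lam \<theta> \<longleftrightarrow>
     z 0 \<in> effdom g \<and> z 1 \<in> effdom g \<and> lam 0 > 0 \<and> zbar 0 = z 1 \<and> \<theta> 0 = 1 \<and>
     (\<forall>k\<ge>1.
        ereal (lam k) =
          min (ereal ((1 / \<phi> + 1 / \<phi>\<^sup>2) * lam (k - 1)))
         (min (ereal (\<phi> * \<delta> * \<theta> (k - 1) / (4 * lam (k - 1))) *
                 quot_infty ((norm (z k - z (k - 1)))\<^sup>2) ((norm (F (z k) - F (z (k - 1))))\<^sup>2))
              (ereal lam_max)) \<and>
        zbar k = ((\<phi> - 1) *\<^sub>R z k + zbar (k - 1)) /\<^sub>R \<phi> \<and>
        z (k + 1) = prox (lam k) g (zbar k - lam k *\<^sub>R F (z k)) \<and>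
        \<theta> k = \<phi> * (lam k / lam (k - 1)))"

definition converges_Q_linearly :: "(nat \<Rightarrow> 'a::real_normed_vector) \<Rightarrow> 'a \<Rightarrow> bool" where
  "converges_Q_linearly u l \<longleftrightarrow> u \<longlonglongrightarrow> l \<and>
     (\<exists>q. 0 < q \<and> q < 1 \<and>
        (\<forall>\<^sub>F k in sequentially. norm (u (k + 1) - l) < q * norm (u k - l)))"

definition converges_R_linearly :: "(nat \<Rightarrow> 'a::real_normed_vector) \<Rightarrow> 'a \<Rightarrow> bool" where
  "converges_R_linearly u l \<longleftrightarrow> u \<longlonglongrightarrow> l \<and>
     (\<exists>\<gamma> :: nat \<Rightarrow> real. converges_Q_linearly \<gamma> 0 \<and>
        (\<forall>\<^sub>F k in sequentially. norm (u k - l) \<le> \<gamma> k))"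

end

theory Submission
  imports Defs
begin

text \<open>The prox inequalities of two consecutive steps make
  \<open>\<phi> / (\<phi> - 1) * \<parallel>zbar k - s\<parallel>\<^sup>2 + \<theta> (k - 1) / 2 * \<parallel>z k - z (k - 1)\<parallel>\<^sup>2\<close>
  a Lyapunov function for every solution \<open>s\<close>; the factor \<open>\<delta> < 1\<close> leaves room to spend part of
  \<open>\<parallel>z (k + 1) - z k\<parallel>\<^sup>2 + \<parallel>z k - zbar k\<parallel>\<^sup>2\<close> at each step. Step sizes stay away from zero, so this
  quantity tends to zero and dominates the squared residual of \<open>z k\<close>; by the error bound it
  eventually dominates the squared distance of \<open>zbar k\<close> to the solution set. Taking for \<open>s\<close> the
  solution nearest to \<open>zbar k\<close>, the Lyapunov function with a slightly smaller weight on its second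
  term contracts by a fixed factor, hence the increments of \<open>z\<close> decay geometrically.\<close>

section \<open>Epigraphs of convex lower semicontinuous functions\<close>

text \<open>Heights are real although \<open>g\<close> is extended-valued: over a Euclidean space
  the epigraph then lies in a Euclidean space, where separation and compactness apply.\<close>

abbreviation epi :: "('a \<Rightarrow> ereal) \<Rightarrow> ('a \<times> real) set" where
  "epi g \<equiv> {(x, t). g x \<le> ereal t}"

lemma effdom_ereal:
  assumes "proper_fun g" "x \<in> effdom g"
  shows "g x = ereal (real_of_ereal (g x))"
  using assms by (cases "g x") (auto simp: proper_fun_def effdom_def)

lemma mem_effdom_le: "g x \<le> ereal t \<Longrightarrow> x \<in> effdom g"
  by (auto simp: effdom_def intro: le_less_trans)

text \<open>\<open>Liminf (at x)\<close> only sees punctured neighbourhoods; the strict inequality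
  at \<open>x\<close> itself fills in the missing point.\<close>

lemma lsc_fun_open_superlevel:
  fixes g :: "'a::t1_space \<Rightarrow> ereal"
  assumes "lsc_fun g"
  shows "open {y. c < g y}"
proof (subst open_subopen, safe)
  fix x assume x: "c < g x"
  have "g x \<le> Liminf (at x) g" using assms by (auto simp: lsc_fun_def)
  then have "\<forall>\<^sub>F y in at x. c < g y" using x by (simp add: le_Liminf_iff)
  then have "\<forall>\<^sub>F y in nhds x. c < g y"
    using x by (auto simp: eventually_nhds_conv_at)
  then show "\<exists>T. open T \<and> x \<in> T \<and> T \<subseteq> {y. c < g y}"
    by (auto simp: eventually_nhds)
qed

text \<open>A real \<open>c\<close> strictly between \<open>t\<close> and \<open>g x\<close> exists
  for every point outside, so the complement is a union of open boxes.\<close>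

lemma lsc_fun_closed_epi:
  fixes g :: "'a::t1_space \<Rightarrow> ereal"
  assumes "lsc_fun g"
  shows "closed (epi g)"
proof -
  have "- epi g = (\<Union>c::real. {y. ereal c < g y} \<times> {..<c})"
  proof (intro set_eqI iffI)
    fix p assume "p \<in> - epi g"
    then obtain x t where p: "p = (x, t)" "ereal t < g x" by (cases p) auto
    then obtain c where "ereal t < ereal c" "ereal c < g x" using ereal_dense2 by blast
    then show "p \<in> (\<Union>c::real. {y. ereal c < g y} \<times> {..<c})" using p by auto
  next
    fix p assume "p \<in> (\<Union>c::real. {y. ereal c < g y} \<times> {..<c})"
    then obtain x t c where p: "p = (x, t)" "ereal c < g x" "t < c" by (cases p) auto
    then have "ereal t < g x" by (meson less_ereal.simps(1) order_less_trans)
    then show "p \<in> - epi g" using p by auto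
  qed
  also have "open \<dots>"
    by (intro open_UN ballI open_Times lsc_fun_open_superlevel assms) auto
  finally show ?thesis by (simp add: closed_def)
qed

text \<open>Closedness of the epigraph lets varying upper bounds on \<open>g\<close> survive in the
  limit although \<open>g\<close> need not be continuous.\<close>

lemma epi_limit:
  fixes g :: "'a::t1_space \<Rightarrow> ereal"
  assumes "lsc_fun g" "X \<longlonglongrightarrow> x" "c \<longlonglongrightarrow> b" "\<And>n. g (X n) \<le> ereal (c n)"
  shows "g x \<le> ereal b"
proof -
  have "(\<lambda>n. (X n, c n)) \<longlonglongrightarrow> (x, b)" by (intro tendsto_Pair assms)
  then have "(x, b) \<in> epi g"
    using Lim_in_closed_set[OF lsc_fun_closed_epi[OF assms(1)]] assms(4)
    by (smt (verit) always_eventually case_prodI mem_Collect_eq trivial_limit_sequentially)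
  then show ?thesis by simp
qed

lemma convex_fun_convex_epi:
  assumes "convex_fun g"
  shows "convex (epi g)"
proof (rule convexI)
  fix p q :: "'a \<times> real" and u v :: real
  assume a: "p \<in> epi g" "q \<in> epi g" "0 \<le> u" "0 \<le> v" "u + v = 1"
  obtain x s y t where pq: "p = (x, s)" "q = (y, t)" by fastforce
  have "g (u *\<^sub>R x + v *\<^sub>R y) \<le> ereal u * g x + ereal v * g y"
    using assms a by (auto simp: convex_fun_def)
  also have "\<dots> \<le> ereal u * ereal s + ereal v * ereal t"
    using a pq by (intro add_mono ereal_mult_left_mono) auto
  finally show "u *\<^sub>R p + v *\<^sub>R q \<in> epi g" using pq by simp
qed

section \<open>Existence and characterization of proximal points\<close>

text \<open>Separate the point \<open>(x0, t0 - 1)\<close> below the graph from the epigraph. The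
  hyperplane is not vertical, because \<open>(x0, t0)\<close> lies on its other side over the same
  base point; so the coefficient \<open>b\<close> of the height is positive and can be divided
  out.\<close>

lemma affine_minorant:
  fixes g :: "'a::euclidean_space \<Rightarrow> ereal"
  assumes "proper_fun g" "convex_fun g" "lsc_fun g"
  shows "\<exists>a \<alpha>. \<forall>x t. g x \<le> ereal t \<longrightarrow> \<alpha> + a \<bullet> x \<le> t"
proof -
  obtain x0 where "x0 \<in> effdom g" using assms(1) by (auto simp: proper_fun_def)
  then obtain t0 where t0: "g x0 = ereal t0" using effdom_ereal[OF assms(1)] by blast
  then have "(x0, t0 - 1) \<notin> epi g" by simp
  then obtain v \<beta> where v: "v \<bullet> (x0, t0 - 1) < \<beta>" "\<forall>p\<in>epi g. \<beta> < v \<bullet> p"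
    using separating_hyperplane_closed_point[OF convex_fun_convex_epi[OF assms(2)]
        lsc_fun_closed_epi[OF assms(3)]] by blast
  obtain w b where wb: "v = (w, b)" by fastforce
  have "\<beta> < w \<bullet> x0 + b * t0" using v(2) t0 wb by auto
  with v(1) wb have b: "b > 0" by (simp add: algebra_simps)
  show ?thesis
  proof (intro exI allI impI)
    fix x t assume "g x \<le> ereal t"
    then have "\<beta> < w \<bullet> x + b * t" using v(2) wb by auto
    then show "\<beta> / b + (- (1/b) *\<^sub>R w) \<bullet> x \<le> t"
      using b by (simp add: field_simps)
  qed
qed

text \<open>Minimizing \<open>\<tau> * t + 1/2 * \<parallel>x - z\<parallel>\<^sup>2\<close> over the closed epigraph replaces the lower
  semicontinuous objective by a continuous one; the affine minorant of \<open>g\<close> bounds its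
  sublevel sets.\<close>

lemma prox_is_minimizer:
  fixes g :: "'a::euclidean_space \<Rightarrow> ereal"
  assumes "proper_fun g" "convex_fun g" "lsc_fun g" "\<tau> > 0"
  shows "ereal \<tau> * g (prox \<tau> g z) + ereal (1/2 * (norm (prox \<tau> g z - z))\<^sup>2)
    \<le> ereal \<tau> * g x + ereal (1/2 * (norm (x - z))\<^sup>2)"
proof -
  define h where "h = (\<lambda>x. ereal \<tau> * g x + ereal (1/2 * (norm (x - z))\<^sup>2))"
  define f where "f = (\<lambda>(x, t). \<tau> * t + 1/2 * (norm (x - z))\<^sup>2)"
  obtain a \<alpha> where minor: "\<And>x t. g x \<le> ereal t \<Longrightarrow> \<alpha> + a \<bullet> x \<le> t"
    using affine_minorant[OF assms(1-3)] by blast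
  obtain x0 where "x0 \<in> effdom g" using assms(1) by (auto simp: proper_fun_def)
  then obtain t0 where t0: "g x0 = ereal t0" using effdom_ereal[OF assms(1)] by blast
  define v where "v = f (x0, t0)"
  define K where "K = epi g \<inter> {p. f p \<le> v}"
  have f_cont: "continuous_on A f" for A
    unfolding f_def case_prod_beta by (intro continuous_intros)
  have "closed K" unfolding K_def
    by (intro closed_Int lsc_fun_closed_epi[OF assms(3)] closed_Collect_le f_cont continuous_intros)
  moreover have "bounded K"
  proof -
    \<comment> \<open>Completing the square in \<open>\<tau>\<close> times the affine minorant plus
      the quadratic term: \<open>m\<close> is the minimizer and \<open>e\<close> the minimum
      value.\<close>
    define m where "m = z - \<tau> *\<^sub>R a"
    define e where "e = \<tau> * \<alpha> + 1/2 * (norm z)\<^sup>2 - 1/2 * (norm m)\<^sup>2"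
    define R where "R = sqrt (2 * (v - e))"
    define B where "B = cball m R \<times> {\<alpha> - norm a * (norm m + R)..v / \<tau>}"
    have "K \<subseteq> B"
    proof
      fix p assume p: "p \<in> K"
      obtain x t where xt: "p = (x, t)" by fastforce
      have 1: "\<alpha> + a \<bullet> x \<le> t" "\<tau> * t + 1/2 * (norm (x - z))\<^sup>2 \<le> v"
        using p minor by (auto simp: xt K_def f_def)
      have "e + 1/2 * (norm (x - m))\<^sup>2 = \<tau> * (\<alpha> + a \<bullet> x) + 1/2 * (norm (x - z))\<^sup>2"
        unfolding e_def m_def
        by (simp add: power2_norm_eq_inner inner_simps inner_commute algebra_simps)
      also have "\<dots> \<le> v" using 1 assms(4) by (smt (verit) mult_left_mono)
      finally have "(norm (x - m))\<^sup>2 \<le> 2 * (v - e)" by simp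
      then have n: "norm (x - m) \<le> R" unfolding R_def by (rule real_le_rsqrt)
      have "\<tau> * t \<le> v" using 1(2) zero_le_power2[of "norm (x - z)"] by linarith
      then have "t \<le> v / \<tau>" using assms(4) by (simp add: field_simps)
      moreover have "\<bar>a \<bullet> x\<bar> \<le> norm a * (norm m + R)"
      proof -
        have "norm x \<le> norm m + R" using n norm_triangle_ineq[of m "x - m"] by simp
        then show ?thesis using Cauchy_Schwarz_ineq2[of a x]
          by (meson mult_left_mono norm_ge_zero order_trans)
      qed
      ultimately show "p \<in> B" using n 1 xt
        by (auto simp: B_def dist_norm norm_minus_commute)
    qed
    moreover have "bounded B" unfolding B_def by (intro bounded_Times) auto
    ultimately show ?thesis using bounded_subset by blast
  qed
  ultimately have "compact K" by (simp add: compact_eq_bounded_closed)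
  moreover have "(x0, t0) \<in> K" using t0 by (simp add: K_def v_def)
  ultimately obtain p where p: "p \<in> K" "\<forall>q\<in>K. f p \<le> f q"
    using continuous_attains_inf[OF _ _ f_cont, of K] by blast
  have min: "f p \<le> f q" if "q \<in> epi g" for q
    using p that by (cases "f q \<le> v") (auto simp: K_def)
  obtain x1 t1 where x1: "p = (x1, t1)" by fastforce
  have "h x1 \<le> h y" for y
  proof (cases "y \<in> effdom g")
    case True
    then obtain t where t: "g y = ereal t" using effdom_ereal[OF assms(1)] by blast
    have "g x1 \<le> ereal t1" using p(1) x1 by (simp add: K_def)
    then have "h x1 \<le> ereal (f p)"
      using ereal_mult_left_mono[of "g x1" "ereal t1" "ereal \<tau>"] assms(4)
      by (auto simp: h_def f_def x1 intro: add_right_mono simp flip: plus_ereal.simps)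
    also have "\<dots> \<le> ereal (f (y, t))" using min[of "(y, t)"] t by simp
    also have "\<dots> = h y" by (simp add: h_def f_def t)
    finally show ?thesis .
  next
    case False
    then have "g y = \<infinity>" by (simp add: effdom_def)
    then show ?thesis using assms(4) by (simp add: h_def)
  qed
  then have "is_arg_min h (\<lambda>_. True) x1" by (simp add: is_arg_min_def not_less)
  \<comment> \<open>\<open>arg_min\<close> is a choice, so exhibiting the minimizer
    \<open>x1\<close> makes the chosen point a minimizer.\<close>
  then have "is_arg_min h (\<lambda>_. True) (arg_min h (\<lambda>_. True))"
    unfolding arg_min_def by (rule someI)
  moreover have "prox \<tau> g z = arg_min h (\<lambda>_. True)"
    by (simp add: prox_def h_def)
  ultimately show ?thesis by (auto simp: is_arg_min_def not_less h_def)
qed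

lemma prox_in_effdom:
  fixes g :: "'a::euclidean_space \<Rightarrow> ereal"
  assumes "proper_fun g" "convex_fun g" "lsc_fun g" "\<tau> > 0"
  shows "prox \<tau> g z \<in> effdom g"
proof (rule ccontr)
  assume "prox \<tau> g z \<notin> effdom g"
  then have inf: "g (prox \<tau> g z) = \<infinity>" by (simp add: effdom_def)
  obtain x0 where "x0 \<in> effdom g" using assms(1) by (auto simp: proper_fun_def)
  then obtain t0 where "g x0 = ereal t0" using effdom_ereal[OF assms(1)] by blast
  then show False using prox_is_minimizer[OF assms, of z x0] inf assms(4) by simp
qed

text \<open>First-order optimality: compare the objective at \<open>p\<close> with its value at a
  point of the segment from \<open>p\<close> to \<open>x\<close>, use convexity of \<open>g\<close>,
  divide by the segment parameter \<open>s\<close> and let \<open>s\<close> tend to 0 from the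
  right.\<close>

lemma prox_inequality:
  fixes g :: "'a::euclidean_space \<Rightarrow> ereal" and z :: 'a
  assumes "proper_fun g" "convex_fun g" "lsc_fun g" "\<tau> > 0" and x: "x \<in> effdom g"
  defines "p \<equiv> prox \<tau> g z"
  shows "(p - z) \<bullet> (x - p) \<ge> \<tau> * (real_of_ereal (g p) - real_of_ereal (g x))"
proof -
  have p: "p \<in> effdom g" unfolding p_def by (rule prox_in_effdom[OF assms(1-4)])
  define a where "a = real_of_ereal (g p)"
  define b where "b = real_of_ereal (g x)"
  have ab: "g p = ereal a" "g x = ereal b"
    unfolding a_def b_def using effdom_ereal[OF assms(1)] p x by blast+
  have bound: "\<tau> * (a - b) \<le> (p - z) \<bullet> (x - p) + s * (1/2 * (norm (x - p))\<^sup>2)"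
    if s: "0 < s" "s < 1" for s
  proof -
    define y where "y = (1 - s) *\<^sub>R p + s *\<^sub>R x"
    have "g y \<le> ereal (1 - s) * g p + ereal s * g x"
      using assms(2) s by (auto simp: convex_fun_def y_def)
    then have gy: "g y \<le> ereal ((1 - s) * a + s * b)" by (simp add: ab)
    then have "y \<in> effdom g" by (rule mem_effdom_le)
    then obtain c where c: "g y = ereal c" using effdom_ereal[OF assms(1)] by blast
    have "\<tau> * a + 1/2 * (norm (p - z))\<^sup>2 \<le> \<tau> * c + 1/2 * (norm (y - z))\<^sup>2"
      using prox_is_minimizer[OF assms(1-4), of z y] by (simp add: c ab flip: p_def)
    also have "\<dots> \<le> \<tau> * ((1 - s) * a + s * b) + 1/2 * (norm (y - z))\<^sup>2"
      using gy c assms(4) by simp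
    also have "(norm (y - z))\<^sup>2 = (norm (p - z))\<^sup>2 + 2 * s * ((p - z) \<bullet> (x - p))
        + s\<^sup>2 * (norm (x - p))\<^sup>2"
      unfolding y_def power2_norm_eq_inner
      by (simp add: inner_simps inner_commute algebra_simps power2_eq_square)
    finally have "s * (\<tau> * (a - b)) \<le>
        s * ((p - z) \<bullet> (x - p) + s * (1/2 * (norm (x - p))\<^sup>2))"
      by (simp add: algebra_simps power2_eq_square)
    then show ?thesis using s by simp
  qed
  have "((\<lambda>s. (p - z) \<bullet> (x - p) + s * (1/2 * (norm (x - p))\<^sup>2)) \<longlongrightarrow>
      (p - z) \<bullet> (x - p) + 0 * (1/2 * (norm (x - p))\<^sup>2)) (at_right 0)"
    by (intro tendsto_intros)
  moreover have "\<forall>\<^sub>F s::real in at_right 0. 0 < s \<and> s < 1"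
    by (auto simp: eventually_at_right[of 0 1] intro!: exI[of _ 1])
  then have "\<forall>\<^sub>F s in at_right 0.
      \<tau> * (a - b) \<le> (p - z) \<bullet> (x - p) + s * (1/2 * (norm (x - p))\<^sup>2)"
    by eventually_elim (use bound in blast)
  ultimately have "\<tau> * (a - b) \<le> (p - z) \<bullet> (x - p) + 0 * (1/2 * (norm (x - p))\<^sup>2)"
    by (rule tendsto_lowerbound) simp
  then show ?thesis by (simp add: a_def b_def)
qed

section \<open>The solution set and the residual\<close>

lemma VI_solutionD:
  assumes "proper_fun g" "s \<in> VI_solutions g F" "x \<in> effdom g"
  shows "real_of_ereal (g s) - real_of_ereal (g x) \<le> F s \<bullet> (x - s)"
proof -
  obtain a b where ab: "g s = ereal a" "g x = ereal b"
    using assms effdom_ereal[OF assms(1)] unfolding VI_solutions_def by blast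
  have "ereal (F s \<bullet> (x - s)) + g x - g s \<ge> 0" using assms by (auto simp: VI_solutions_def)
  then show ?thesis by (simp add: ab zero_ereal_def)
qed

text \<open>Closedness later provides a nearest solution and places the limit of the iterates in the
  set. \<open>F\<close> is controlled on \<open>effdom g\<close> only, so the limit is shown to lie
  there before continuity of \<open>F\<close> is used.\<close>

lemma closed_VI_solutions:
  fixes g :: "'a::euclidean_space \<Rightarrow> ereal"
  assumes "proper_fun g" "lsc_fun g" "L-lipschitz_on (effdom g) F"
  shows "closed (VI_solutions g F)"
  unfolding closed_sequential_limits
proof (intro allI impI, elim conjE)
  fix X x assume X: "\<forall>n. X n \<in> VI_solutions g F" and lim: "X \<longlonglongrightarrow> x"
  have dom: "X n \<in> effdom g" for n using X by (auto simp: VI_solutions_def)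
  have sol: "g (X n) \<le> ereal (F (X n) \<bullet> (w - X n) + real_of_ereal (g w))" if w: "w \<in> effdom g" for n w
  proof -
    have "real_of_ereal (g (X n)) \<le> F (X n) \<bullet> (w - X n) + real_of_ereal (g w)"
      using VI_solutionD[OF assms(1) _ w] X by (smt (verit))
    then show ?thesis using effdom_ereal[OF assms(1) dom] by (metis ereal_less_eq(3))
  qed
  have x_dom: "x \<in> effdom g"
  proof -
    \<comment> \<open>A fixed test point of the domain: the Lipschitz bound relative to
      \<open>w\<close> controls \<open>F (X n)\<close> without evaluating \<open>F\<close> at
      \<open>x\<close>.\<close>
    define w where "w = X 0"
    have w: "w \<in> effdom g" using dom by (simp add: w_def)
    define c where "c n = (norm (F w) + L * norm (X n - w)) * norm (w - X n) + real_of_ereal (g w)" for n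
    have "F (X n) \<bullet> (w - X n) \<le> (norm (F w) + L * norm (X n - w)) * norm (w - X n)" for n
    proof -
      have "norm (F (X n) - F w) \<le> L * norm (X n - w)"
        using assms(3) dom w by (auto simp: lipschitz_on_def dist_norm)
      then have "norm (F (X n)) \<le> norm (F w) + L * norm (X n - w)"
        using norm_triangle_ineq[of "F w" "F (X n) - F w"] by simp
      then show ?thesis using Cauchy_Schwarz_ineq2[of "F (X n)" "w - X n"]
        by (smt (verit) mult_right_mono norm_ge_zero)
    qed
    then have "g (X n) \<le> ereal (c n)" for n
      using sol[OF w, of n] by (auto simp: c_def intro: order_trans)
    moreover have "c \<longlonglongrightarrow> (norm (F w) + L * norm (x - w)) * norm (w - x) + real_of_ereal (g w)"
      unfolding c_def by (intro tendsto_intros lim)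
    ultimately have "g x \<le> ereal ((norm (F w) + L * norm (x - w)) * norm (w - x) + real_of_ereal (g w))"
      using epi_limit[OF assms(2) lim] by blast
    then show ?thesis by (rule mem_effdom_le)
  qed
  have F_lim: "(\<lambda>n. F (X n)) \<longlonglongrightarrow> F x"
    using lipschitz_on_continuous_on[OF assms(3)] x_dom dom lim by (simp add: continuous_on_sequentially comp_def)
  have "0 \<le> ereal (F x \<bullet> (w - x)) + g w - g x" for w
  proof (cases "w \<in> effdom g")
    case True
    have "(\<lambda>n. F (X n) \<bullet> (w - X n) + real_of_ereal (g w)) \<longlonglongrightarrow> F x \<bullet> (w - x) + real_of_ereal (g w)"
      by (intro tendsto_intros F_lim lim)
    then have *: "g x \<le> ereal (F x \<bullet> (w - x) + real_of_ereal (g w))"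
      using epi_limit[OF assms(2) lim] sol[OF True] by blast
    obtain a b where ab: "g x = ereal a" "g w = ereal b"
      using effdom_ereal[OF assms(1)] True x_dom by blast
    show ?thesis using * by (simp add: ab zero_ereal_def)
  next
    case False
    obtain a where a: "g x = ereal a"
      using effdom_ereal[OF assms(1)] x_dom by blast
    have "g w = \<infinity>" using False by (simp add: effdom_def)
    then show ?thesis by (simp add: a)
  qed
  then show "x \<in> VI_solutions g F" using x_dom by (simp add: VI_solutions_def)
qed

text \<open>Adding the prox inequalities of both points cancels \<open>F z\<close> and \<open>g\<close>, so no monotonicity
  of the residual in the step size is needed.\<close>

lemma norm_residual_le:
  fixes g :: "'a::euclidean_space \<Rightarrow> ereal" and F :: "'a \<Rightarrow> 'a" and z b :: 'a
  assumes "proper_fun g" "convex_fun g" "lsc_fun g" "\<tau> > 0" "t > 0"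
  defines "w \<equiv> prox t g (b - t *\<^sub>R F z)"
  shows "norm (residual g F z \<tau>) \<le> 2 * norm (w - z) + \<tau> / t * norm (w - b)"
proof -
  define p where "p = prox \<tau> g (z - \<tau> *\<^sub>R F z)"
  have dom: "p \<in> effdom g" "w \<in> effdom g"
    unfolding p_def w_def by (rule prox_in_effdom; use assms in simp)+
  define d where "d = real_of_ereal (g p) - real_of_ereal (g w)"
  have "(p - z + \<tau> *\<^sub>R F z) \<bullet> (w - p) \<ge> \<tau> * d"
    using prox_inequality[OF assms(1-4) dom(2), of "z - \<tau> *\<^sub>R F z", folded p_def]
    by (simp add: d_def diff_diff_eq2 diff_add_eq)
  then have 1: "(p - z) \<bullet> (w - p) / \<tau> + F z \<bullet> (w - p) \<ge> d"
    using assms(4) by (simp add: inner_add_left inner_diff_left field_simps)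
  have "(w - b + t *\<^sub>R F z) \<bullet> (p - w) \<ge> t * (- d)"
    using prox_inequality[OF assms(1-3,5) dom(1), of "b - t *\<^sub>R F z", folded w_def]
    by (simp add: d_def diff_diff_eq2 diff_add_eq)
  then have "(w - b) \<bullet> (p - w) / t + F z \<bullet> (p - w) \<ge> - d"
    using assms(5) by (simp add: inner_add_left inner_diff_left field_simps)
  then have "(p - z) \<bullet> (w - p) / \<tau> - (w - b) \<bullet> (w - p) / t \<ge> 0"
    using 1 by (simp add: inner_diff_right diff_divide_distrib)
  \<comment> \<open>Splitting \<open>p - z\<close> into \<open>(w - z) - (w - p)\<close> produces
    the negative square that turns the inequality into a bound on
    \<open>norm (w - p)\<close>.\<close>
  moreover have "(p - z) \<bullet> (w - p) = (w - z) \<bullet> (w - p) - (norm (w - p))\<^sup>2"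
    by (simp add: power2_norm_eq_inner inner_simps)
  ultimately have "(norm (w - p))\<^sup>2 \<le> (w - z) \<bullet> (w - p) - \<tau> / t * ((w - b) \<bullet> (w - p))"
    using assms(4) by (simp add: field_simps)
  also have "\<dots> = (w - z - (\<tau> / t) *\<^sub>R (w - b)) \<bullet> (w - p)"
    by (simp add: inner_diff_left)
  also have "\<dots> \<le> norm (w - z - (\<tau> / t) *\<^sub>R (w - b)) * norm (w - p)"
    by (rule norm_cauchy_schwarz)
  finally have "norm (w - p) \<le> norm (w - z - (\<tau> / t) *\<^sub>R (w - b))"
    by (cases "w = p") (auto simp: power2_eq_square)
  also have "\<dots> \<le> norm (w - z) + \<tau> / t * norm (w - b)"
    using norm_triangle_ineq4[of "w - z" "(\<tau> / t) *\<^sub>R (w - b)"] assms(4,5) by simp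
  finally have "norm (w - p) \<le> norm (w - z) + \<tau> / t * norm (w - b)" .
  moreover have "norm (z - p) \<le> norm (w - z) + norm (w - p)"
    using norm_triangle_ineq[of "z - w" "w - p"] by (simp add: norm_minus_commute)
  ultimately show ?thesis by (simp add: residual_def p_def)
qed

section \<open>From geometric increments to a linear rate\<close>

text \<open>The increments sum to a geometric tail, so the sequence is Cauchy and
  \<open>M * q ^ k\<close> is a Q-linear majorant of the distance to its limit.\<close>

lemma R_linear_of_geometric_increments:
  fixes u :: "nat \<Rightarrow> 'a::banach"
  assumes q: "0 < q" "q < 1" and C: "C > 0"
    and inc: "\<And>k. k \<ge> K \<Longrightarrow> norm (u (k + 1) - u k) \<le> C * q ^ k"
  shows "\<exists>l. converges_R_linearly u l"
proof -
  define M where "M = C / (1 - q)"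
  have M: "M > 0" using q C by (simp add: M_def)
  \<comment> \<open>The difference \<open>q ^ k - q ^ m\<close>, rather than \<open>q ^ k\<close>
    alone, lets the induction on \<open>m\<close> close.\<close>
  have tele: "norm (u m - u k) \<le> M * (q ^ k - q ^ m)" if "K \<le> k" "k \<le> m" for k m
    using that(2)
  proof (induction m rule: dec_induct)
    case (step n)
    have "norm (u (Suc n) - u k) \<le> norm (u (n + 1) - u n) + norm (u n - u k)"
      using norm_triangle_ineq[of "u (n + 1) - u n" "u n - u k"] by simp
    also have "\<dots> \<le> C * q ^ n + M * (q ^ k - q ^ n)"
      using inc[of n] step that by simp
    also have "C * q ^ n = M * (q ^ n - q ^ Suc n)" using q by (simp add: M_def field_simps)
    finally show ?case by (simp add: algebra_simps)
  qed simp
  have tele': "norm (u m - u k) \<le> M * q ^ k" if "K \<le> k" "k \<le> m" for k m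
    using tele[OF that] M q by (smt (verit) mult_left_mono zero_le_power)
  have gam0: "(\<lambda>k. M * q ^ k) \<longlonglongrightarrow> 0"
    using tendsto_mult_right_zero[OF LIMSEQ_realpow_zero, of q M] q by simp
  have "Cauchy u"
  proof (rule metric_CauchyI)
    fix e :: real assume "e > 0"
    then have "\<forall>\<^sub>F k in sequentially. M * q ^ k < e / 2"
      using order_tendstoD(2)[OF gam0, of "e / 2"] by simp
    then obtain N where N: "M * q ^ N < e / 2" "N \<ge> K"
      using eventually_ge_at_top[of K] eventually_happens[OF eventually_conj] by fastforce
    show "\<exists>N. \<forall>m\<ge>N. \<forall>n\<ge>N. dist (u m) (u n) < e"
    proof (intro exI allI impI)
      fix m n assume "m \<ge> N" "n \<ge> N"
      then have "dist (u m) (u N) < e / 2" "dist (u n) (u N) < e / 2"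
        using tele'[of N m] tele'[of N n] N by (auto simp: dist_norm)
      then show "dist (u m) (u n) < e" by (rule dist_triangle_half_l)
    qed
  qed
  then obtain l where l: "u \<longlonglongrightarrow> l" using Cauchy_convergent convergent_def by blast
  have "norm (u k - l) \<le> M * q ^ k" if "k \<ge> K" for k
  proof -
    have "(\<lambda>m. norm (u m - u k)) \<longlonglongrightarrow> norm (l - u k)" by (intro tendsto_intros l)
    then have "norm (l - u k) \<le> M * q ^ k"
      by (rule Lim_bounded[where M = k]) (use tele' that in auto)
    then show ?thesis by (simp add: norm_minus_commute)
  qed
  moreover have "converges_Q_linearly (\<lambda>k. M * q ^ k) 0"
    unfolding converges_Q_linearly_def
  \<comment> \<open>The majorant has ratio exactly \<open>q\<close> while a strict inequality is
    demanded, so the rate is taken strictly between \<open>q\<close> and 1.\<close>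
  proof (intro conjI gam0 exI[of _ "(1 + q) / 2"] always_eventually allI)
    show "norm (M * q ^ (k + 1) - 0) < (1 + q) / 2 * norm (M * q ^ k - 0)" for k
      using q M by (simp add: abs_mult field_simps)
  qed (use q in auto)
  ultimately have "converges_R_linearly u l"
    unfolding converges_R_linearly_def using l by (auto simp: eventually_at_top_linorder)
  then show ?thesis by blast
qed

section \<open>The step-size rule in real terms and the one-step estimate\<close>

text \<open>The product form \<open>l * q \<le> c * p\<close> also covers \<open>q = 0\<close>,
  where the quotient is infinite; the disjunction records which term attains the minimum.\<close>

lemma min_quot_inftyD:
  assumes "ereal l = min (ereal a) (min (ereal c * quot_infty p q) (ereal m))"
    and "c > 0" "p \<ge> 0" "q \<ge> 0"
  shows "l \<le> a" "l \<le> m" "l * q \<le> c * p" "l = a \<or> l = m \<or> (q > 0 \<and> l = c * p / q)"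
proof -
  show "l \<le> a" "l \<le> m"
    using assms(1) by (metis ereal_less_eq(3) min.cobounded1 min.cobounded2 min.coboundedI2)+
  show "l * q \<le> c * p"
  proof (cases "q = 0")
    case False
    then have "ereal l \<le> ereal (c * p / q)"
      using assms(1) by (auto simp: quot_infty_def min_def split: if_splits)
    then have "l \<le> c * p / q" by (simp only: ereal_less_eq)
    then show ?thesis using False assms(4) by (simp add: field_simps)
  qed (use assms in simp)
  show "l = a \<or> l = m \<or> (q > 0 \<and> l = c * p / q)"
    using assms by (auto simp: quot_infty_def min_def split: if_splits)
qed


text \<open>Instantiated with \<open>x\<close> a solution, \<open>y'\<close>, \<open>y\<close>, \<open>w\<close> three consecutive iterates, \<open>b\<close>, \<open>b'\<close>
  two consecutive averages, \<open>t'\<close>, \<open>t\<close> the values of \<open>\<theta>\<close> and \<open>l\<close> the current step size.\<close>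

lemma graal_estimate:
  fixes x y y' w b b' F F' :: "'a::real_inner"
  assumes \<phi>: "\<phi> > 1" and b': "\<phi> *\<^sub>R b' = (\<phi> - 1) *\<^sub>R w + b" and t: "t \<le> 1 + 1 / \<phi>"
    and var: "(w - b) \<bullet> (x - w) + t * ((y - b) \<bullet> (w - y)) + l * ((F - F') \<bullet> (y - w)) \<ge> 0"
    and step: "l\<^sup>2 * (norm (F - F'))\<^sup>2 \<le> \<delta> * t * t' / 4 * (norm (y - y'))\<^sup>2"
    and nn: "l \<ge> 0" "t \<ge> 0" "t' \<ge> 0" "\<delta> \<ge> 0"
  shows "\<phi> / (\<phi> - 1) * (norm (b' - x))\<^sup>2 + t / 2 * (norm (w - y))\<^sup>2 + t * (norm (y - b))\<^sup>2
    \<le> \<phi> / (\<phi> - 1) * (norm (b - x))\<^sup>2 + \<delta> * (t' / 2 * (norm (y - y'))\<^sup>2)"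
proof -
  have i: "2 * ((w - b) \<bullet> (x - w)) = (norm (b - x))\<^sup>2 - (norm (w - b))\<^sup>2 - (norm (w - x))\<^sup>2"
    unfolding power2_norm_eq_inner by (simp add: inner_simps inner_commute)
  have ii: "2 * ((y - b) \<bullet> (w - y)) = (norm (w - b))\<^sup>2 - (norm (w - y))\<^sup>2 - (norm (y - b))\<^sup>2"
    unfolding power2_norm_eq_inner by (simp add: inner_simps inner_commute)
  \<comment> \<open>\<open>w\<close> is the affine combination of \<open>b'\<close> and
    \<open>b\<close> with weights \<open>\<phi> / (\<phi> - 1)\<close> and
    \<open>- 1 / (\<phi> - 1)\<close>; this is the norm identity for such combinations.\<close>
  have iii: "(norm (w - x))\<^sup>2 = \<phi> / (\<phi> - 1) * (norm (b' - x))\<^sup>2 - 1 / (\<phi> - 1) * (norm (b - x))\<^sup>2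
      + 1 / \<phi> * (norm (w - b))\<^sup>2"
  proof -
    define u where "u = w - x"
    define v where "v = b - x"
    have "\<phi> *\<^sub>R (b' - x) = (\<phi> - 1) *\<^sub>R u + v"
      unfolding u_def v_def using b' by (simp add: algebra_simps)
    then have "(norm (\<phi> *\<^sub>R (b' - x)))\<^sup>2 = (norm ((\<phi> - 1) *\<^sub>R u + v))\<^sup>2" by simp
    then have e: "\<phi>\<^sup>2 * (norm (b' - x))\<^sup>2 = (\<phi> - 1)\<^sup>2 * (u \<bullet> u) + 2 * (\<phi> - 1) * (u \<bullet> v) + v \<bullet> v"
      unfolding power2_norm_eq_inner
      by (simp add: inner_simps inner_commute algebra_simps power2_eq_square)
    have wb: "(norm (w - b))\<^sup>2 = u \<bullet> u - 2 * (u \<bullet> v) + v \<bullet> v"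
      unfolding power2_norm_eq_inner u_def v_def by (simp add: inner_simps inner_commute)
    have "\<phi> * (\<phi> - 1) * (\<phi> / (\<phi> - 1) * (norm (b' - x))\<^sup>2 - 1 / (\<phi> - 1) * (v \<bullet> v)
        + 1 / \<phi> * (norm (w - b))\<^sup>2)
      = \<phi> * ((\<phi> - 1) * (\<phi> / (\<phi> - 1))) * (norm (b' - x))\<^sup>2
        - \<phi> * ((\<phi> - 1) * (1 / (\<phi> - 1))) * (v \<bullet> v) + (\<phi> - 1) * (\<phi> * (1 / \<phi>)) * (norm (w - b))\<^sup>2"
    proof -
      \<comment> \<open>With the quotients abstracted to variables, ring normalization only regroups
        products; the cancellations come in the next step.\<close>
      have "p * r * (a * n - c * m + d * k) = p * (r * a) * n - p * (r * c) * m + r * (p * d) * k"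
        for p r a n c m d k :: real by (simp add: algebra_simps)
      then show ?thesis .
    qed
    also have "\<dots> = \<phi>\<^sup>2 * (norm (b' - x))\<^sup>2 - \<phi> * (v \<bullet> v) + (\<phi> - 1) * (norm (w - b))\<^sup>2"
      using \<phi> by (simp add: power2_eq_square)
    also have "\<dots> = \<phi> * (\<phi> - 1) * (u \<bullet> u)"
      unfolding e wb by (simp add: algebra_simps power2_eq_square)
    finally show ?thesis using \<phi> by (simp add: power2_norm_eq_inner u_def v_def)
  qed
  \<comment> \<open>Cauchy-Schwarz followed by the arithmetic-geometric mean inequality; the divisor
    4 in \<open>step\<close> yields exactly these two halves.\<close>
  have cross: "2 * (l * ((F - F') \<bullet> (y - w)))
      \<le> t / 2 * (norm (w - y))\<^sup>2 + \<delta> * (t' / 2 * (norm (y - y'))\<^sup>2)"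
  proof -
    define A where "A = norm (w - y)"
    define B where "B = norm (y - y')"
    define N where "N = l * norm (F - F')"
    have N: "N \<ge> 0" "N\<^sup>2 \<le> \<delta> * t * t' / 4 * B\<^sup>2" "A \<ge> 0"
      using step nn by (auto simp: N_def A_def B_def power_mult_distrib)
    have "(2 * N * A)\<^sup>2 = 4 * N\<^sup>2 * A\<^sup>2" by (simp add: power_mult_distrib)
    also have "\<dots> \<le> 4 * (\<delta> * t * t' / 4 * B\<^sup>2) * A\<^sup>2"
      using N(2) by (intro mult_right_mono mult_left_mono) auto
    also have "\<dots> = (t * A\<^sup>2) * (\<delta> * t' * B\<^sup>2)" by simp
    also have "\<dots> \<le> (t / 2 * A\<^sup>2 + \<delta> * (t' / 2 * B\<^sup>2))\<^sup>2"
    proof -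
      have "p * q \<le> (p / 2 + q / 2)\<^sup>2" for p q :: real
        using zero_le_power2[of "p - q"] by (simp add: field_simps power2_eq_square)
      from this[of "t * A\<^sup>2" "\<delta> * t' * B\<^sup>2"] show ?thesis by (simp add: mult.assoc)
    qed
    finally have "2 * N * A \<le> t / 2 * A\<^sup>2 + \<delta> * (t' / 2 * B\<^sup>2)"
      by (rule power2_le_imp_le) (use nn in auto)
    moreover have "l * ((F - F') \<bullet> (y - w)) \<le> N * A"
      using mult_left_mono[OF norm_cauchy_schwarz[of "F - F'" "y - w"] nn(1)]
      by (simp add: N_def A_def norm_minus_commute)
    ultimately show ?thesis by (simp add: A_def B_def)
  qed
  \<comment> \<open>The square of \<open>norm (w - b)\<close> collects the coefficient
    \<open>t\<close> from \<open>ii\<close>, -1 from \<open>i\<close> and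
    \<open>- 1 / \<phi>\<close> from \<open>iii\<close>.\<close>
  have "(t - 1 - 1 / \<phi>) * (norm (w - b))\<^sup>2 \<le> 0" using t by (simp add: mult_nonpos_nonneg)
  moreover have "\<phi> / (\<phi> - 1) = 1 + 1 / (\<phi> - 1)" using \<phi> by (simp add: field_simps)
  then have "\<phi> / (\<phi> - 1) * (norm (b - x))\<^sup>2 = (norm (b - x))\<^sup>2 + 1 / (\<phi> - 1) * (norm (b - x))\<^sup>2"
    by (simp add: distrib_right)
  moreover have "t * (2 * ((y - b) \<bullet> (w - y)))
      = t * (norm (w - b))\<^sup>2 - t * (norm (w - y))\<^sup>2 - t * (norm (y - b))\<^sup>2"
    unfolding ii by (simp add: algebra_simps)
  ultimately show ?thesis using var i iii cross by (simp add: left_diff_distrib)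
qed

section \<open>Runs of the algorithm and bounds on their step sizes\<close>

locale graal =
  fixes g :: "'a::euclidean_space \<Rightarrow> ereal" and F :: "'a \<Rightarrow> 'a"
    and L \<phi> \<delta> lam_max :: real
    and z zbar :: "nat \<Rightarrow> 'a" and lam \<theta> :: "nat \<Rightarrow> real"
  assumes proper: "proper_fun g" and conv: "convex_fun g" and lsc: "lsc_fun g"
    and mono: "monotone_operator_on (effdom g) F"
    and lips: "L-lipschitz_on (effdom g) F"
    and phi1: "1 < \<phi>" and phi_le: "\<phi> \<le> golden_ratio"
    and lam_max: "lam_max > 0"
    and delta0: "0 < \<delta>" and delta1: "\<delta> < 1"
    and run: "adaptive_graal g F \<phi> \<delta> lam_max z zbar lam \<theta>"
begin

definition "\<rho> = 1 / \<phi> + 1 / \<phi>\<^sup>2"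

text \<open>The right-hand side is the bound that \<open>graal_estimate\<close> puts on
  \<open>t\<close>; this explains the choice of the growth factor \<open>\<rho>\<close>.\<close>

lemma phi_rho: "\<phi> * \<rho> = 1 + 1 / \<phi>"
  using phi1 by (simp add: \<rho>_def field_simps power2_eq_square)

text \<open>Being at most the golden ratio means that the square of \<open>\<phi>\<close> is at most
  \<open>\<phi> + 1\<close>. Hence the first term of the minimum never forces the step size to
  shrink.\<close>

lemma rho_ge_1: "\<rho> \<ge> 1"
proof -
  have "\<phi> - 1/2 \<le> sqrt 5 / 2" using phi_le by (simp add: golden_ratio_def field_simps)
  then have "(\<phi> - 1/2)\<^sup>2 \<le> (sqrt 5 / 2)\<^sup>2" using phi1 by (intro power_mono) auto
  then have "\<phi>\<^sup>2 \<le> \<phi> + 1" by (simp add: power2_eq_square field_simps)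
  then show ?thesis using phi1 by (simp add: \<rho>_def field_simps power2_eq_square)
qed

lemma z_Suc: "k \<ge> 1 \<Longrightarrow> z (k + 1) = prox (lam k) g (zbar k - lam k *\<^sub>R F (z k))"
  and zbar_eq: "k \<ge> 1 \<Longrightarrow> zbar k = ((\<phi> - 1) *\<^sub>R z k + zbar (k - 1)) /\<^sub>R \<phi>"
  and theta_eq: "k \<ge> 1 \<Longrightarrow> \<theta> k = \<phi> * (lam k / lam (k - 1))"
  using run by (auto simp: adaptive_graal_def)

lemma zbar_scaled: "k \<ge> 1 \<Longrightarrow> \<phi> *\<^sub>R zbar k = (\<phi> - 1) *\<^sub>R z k + zbar (k - 1)"
  using zbar_eq[of k] phi1 by simp

lemma z_minus_zbar: "k \<ge> 1 \<Longrightarrow> z k - zbar (k - 1) = \<phi> *\<^sub>R (z k - zbar k)"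
  using zbar_scaled[of k] by (simp add: algebra_simps)

lemma step_choice:
  assumes "k \<ge> 1"
  shows "ereal (lam k) = min (ereal (\<rho> * lam (k - 1)))
    (min (ereal (\<phi> * \<delta> * \<theta> (k - 1) / (4 * lam (k - 1))) *
        quot_infty ((norm (z k - z (k - 1)))\<^sup>2) ((norm (F (z k) - F (z (k - 1))))\<^sup>2))
      (ereal lam_max))"
  using run assms unfolding adaptive_graal_def \<rho>_def by blast

text \<open>Each of the two sequences enters the recursion of the other, hence the joint induction.
  When the quotient term is active, the values of \<open>F\<close> differ, so the iterates differ
  and the quotient is positive.\<close>

lemma lam_theta_pos: "lam k > 0 \<and> \<theta> k > 0"
proof (induction k)
  case 0
  then show ?case using run by (auto simp: adaptive_graal_def)
next
  case (Suc k)
  have c: "\<phi> * \<delta> * \<theta> k / (4 * lam k) > 0" using Suc phi1 delta0 by simp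
  have "\<rho> * lam k > 0" using rho_ge_1 Suc by simp
  moreover have "norm (z (Suc k) - z k) > 0" if "norm (F (z (Suc k)) - F (z k)) > 0"
    using that by auto
  ultimately have "lam (Suc k) > 0"
    using min_quot_inftyD(4)[OF step_choice[of "Suc k"]] c lam_max
    by (auto simp del: times_divide_eq_left)
  then show ?case using Suc phi1 theta_eq[of "Suc k"] by simp
qed

lemmas lam_pos = lam_theta_pos[THEN conjunct1] and theta_pos = lam_theta_pos[THEN conjunct2]

lemma step_coeff_pos: "\<phi> * \<delta> * \<theta> k / (4 * lam k) > 0"
  using lam_pos theta_pos phi1 delta0 by simp

lemma z_dom: "z k \<in> effdom g"
proof (cases "k \<le> 1")
  case True
  then show ?thesis using run by (cases k) (auto simp: adaptive_graal_def)
next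
  case False
  then show ?thesis using z_Suc[of "k - 1"] prox_in_effdom[OF proper conv lsc lam_pos] by simp
qed

lemmas step_choice_cases = min_quot_inftyD(4)[OF step_choice step_coeff_pos zero_le_power2 zero_le_power2]

lemma lam_le:
  assumes "k \<ge> 1"
  shows "lam k \<le> \<rho> * lam (k - 1)" "lam k \<le> lam_max"
  using min_quot_inftyD(1,2)[OF step_choice[OF assms] step_coeff_pos] by auto

lemma theta_le:
  assumes "k \<ge> 1"
  shows "\<theta> k \<le> 1 + 1 / \<phi>"
proof -
  have "lam k / lam (k - 1) \<le> \<rho>" using lam_le(1)[OF assms] lam_pos[of "k - 1"] by (simp add: field_simps)
  then have "\<phi> * (lam k / lam (k - 1)) \<le> \<phi> * \<rho>" using phi1 by (intro mult_left_mono) auto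
  then show ?thesis by (simp only: theta_eq[OF assms] phi_rho)
qed

text \<open>Multiplying the quotient bound by \<open>lam k\<close> turns
  \<open>\<phi> * lam k / lam (k - 1)\<close> into \<open>\<theta> k\<close>, giving the premise
  \<open>step\<close> of \<open>graal_estimate\<close>.\<close>

lemma step_lipschitz:
  assumes "k \<ge> 1"
  shows "(lam k)\<^sup>2 * (norm (F (z k) - F (z (k - 1))))\<^sup>2
    \<le> \<delta> * \<theta> k * \<theta> (k - 1) / 4 * (norm (z k - z (k - 1)))\<^sup>2"
proof -
  have "lam k * (norm (F (z k) - F (z (k - 1))))\<^sup>2
      \<le> \<phi> * \<delta> * \<theta> (k - 1) / (4 * lam (k - 1)) * (norm (z k - z (k - 1)))\<^sup>2"
    using min_quot_inftyD(3)[OF step_choice[OF assms] step_coeff_pos] by simp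
  then have "lam k * (lam k * (norm (F (z k) - F (z (k - 1))))\<^sup>2)
      \<le> lam k * (\<phi> * \<delta> * \<theta> (k - 1) / (4 * lam (k - 1)) * (norm (z k - z (k - 1)))\<^sup>2)"
    using lam_pos[of k] by (intro mult_left_mono) auto
  then show ?thesis by (simp add: theta_eq[OF assms] power2_eq_square mult_ac)
qed

text \<open>In the quotient case, unfolding \<open>\<theta> k\<close> cancels \<open>lam k\<close>,
  and the rest is bounded through the Lipschitz constant and
  \<open>lam (k - 1) \<le> lam_max\<close>. The latter bound starts at index 1, since
  \<open>lam 0\<close> is a free input, so the induction starts at 2.\<close>

lemma lam_lower_bound: "\<exists>m>0. \<forall>k\<ge>2. m \<le> lam k"
proof -
  \<comment> \<open>\<open>L + 1\<close> instead of \<open>L\<close> keeps \<open>M\<close> positive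
    when \<open>L = 0\<close>.\<close>
  define M where "M = (L + 1)\<^sup>2"
  have L: "L \<ge> 0" using lips by (rule lipschitz_on_nonneg)
  define c where "c = \<phi>\<^sup>2 * \<delta> / (4 * M * lam_max)"
  define m where "m = min (lam 2) (min lam_max c)"
  have M: "M > 0" using L by (simp add: M_def)
  have "c > 0" using M phi1 delta0 lam_max by (simp add: c_def)
  then have "m > 0" using lam_pos lam_max by (simp add: m_def)
  moreover have "m \<le> lam k" if "k \<ge> 2" for k using that
  proof (induction k rule: dec_induct)
    case base
    then show ?case by (simp add: m_def)
  next
    case (step k)
    let ?dF = "norm (F (z (Suc k)) - F (z k))" and ?dz = "norm (z (Suc k) - z k)"
    consider "lam (Suc k) = \<rho> * lam k" | "lam (Suc k) = lam_max"
      | "?dF\<^sup>2 > 0" "lam (Suc k) = \<phi> * \<delta> * \<theta> k / (4 * lam k) * ?dz\<^sup>2 / ?dF\<^sup>2"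
      using step_choice_cases[of "Suc k"] by auto
    then show ?case
    proof cases
      case 1
      then show ?thesis using step.IH rho_ge_1 lam_pos[of k]
        by (metis less_eq_real_def mult_le_cancel_right1 order_trans not_less)
    next
      case 2
      then show ?thesis by (simp add: m_def)
    next
      case 3
      have "?dF \<le> L * ?dz" using lips z_dom by (auto simp: lipschitz_on_def dist_norm)
      also have "\<dots> \<le> (L + 1) * ?dz" by (simp add: distrib_right)
      finally have "?dF\<^sup>2 \<le> M * ?dz\<^sup>2"
        unfolding M_def power_mult_distrib[symmetric] by (intro power_mono) auto
      then have q: "1 / M \<le> ?dz\<^sup>2 / ?dF\<^sup>2" using 3(1) M by (simp add: field_simps)
      have k: "k \<ge> 1" "k - 1 \<ge> 1" using step by auto
      have "c = \<phi>\<^sup>2 * \<delta> / (4 * lam_max) * (1 / M)" by (simp add: c_def)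
      also have "\<dots> \<le> \<phi>\<^sup>2 * \<delta> / (4 * lam (k - 1)) * (?dz\<^sup>2 / ?dF\<^sup>2)"
        using lam_le(2)[OF k(2)] lam_pos[of "k - 1"] q phi1 delta0 M lam_max
        by (intro mult_mono divide_left_mono) auto
      also have "\<dots> = lam (Suc k)"
        using 3(2) lam_pos[of k] by (simp add: theta_eq[OF k(1)] power2_eq_square mult_ac)
      finally show ?thesis by (simp add: m_def)
    qed
  qed
  ultimately show ?thesis by blast
qed

section \<open>Lyapunov descent\<close>

text \<open>Three inequalities are added: the prox inequality of \<open>z (k + 1)\<close> tested at
  \<open>s\<close>, that of \<open>z k\<close> tested at \<open>z (k + 1)\<close>, and the
  variational inequality with monotonicity at \<open>z k\<close>; the values of \<open>g\<close>
  cancel. Since \<open>z k\<close> must itself come from a prox step,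
  \<open>k \<ge> 2\<close>.\<close>

lemma lyapunov_step:
  assumes k: "k \<ge> 2" and s: "s \<in> VI_solutions g F"
  shows "\<phi> / (\<phi> - 1) * (norm (zbar (k + 1) - s))\<^sup>2 + \<theta> k / 2 * (norm (z (k + 1) - z k))\<^sup>2
      + \<theta> k * (norm (z k - zbar k))\<^sup>2
    \<le> \<phi> / (\<phi> - 1) * (norm (zbar k - s))\<^sup>2 + \<delta> * (\<theta> (k - 1) / 2 * (norm (z k - z (k - 1)))\<^sup>2)"
proof (rule graal_estimate[where l = "lam k" and F = "F (z k)" and F' = "F (z (k - 1))"])
  have k1: "k \<ge> 1" "k - 1 \<ge> 1" "k - 1 + 1 = k" using k by auto
  let ?G = "\<lambda>x. real_of_ereal (g x)"
  have s_dom: "s \<in> effdom g" using s by (simp add: VI_solutions_def)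
  have "(z (k + 1) - zbar k + lam k *\<^sub>R F (z k)) \<bullet> (s - z (k + 1))
      \<ge> lam k * (?G (z (k + 1)) - ?G s)"
    using prox_inequality[OF proper conv lsc lam_pos[of k] s_dom, of "zbar k - lam k *\<^sub>R F (z k)"]
    unfolding z_Suc[OF k1(1), symmetric] by (simp add: diff_diff_eq2 diff_add_eq)
  then have 1: "(z (k + 1) - zbar k) \<bullet> (s - z (k + 1)) + lam k * (F (z k) \<bullet> (s - z (k + 1)))
      \<ge> lam k * (?G (z (k + 1)) - ?G s)"
    by (simp add: inner_add_left)
  have "(z k - zbar (k - 1) + lam (k - 1) *\<^sub>R F (z (k - 1))) \<bullet> (z (k + 1) - z k)
      \<ge> lam (k - 1) * (?G (z k) - ?G (z (k + 1)))"
    using prox_inequality[OF proper conv lsc lam_pos[of "k - 1"] z_dom[of "k + 1"],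
        of "zbar (k - 1) - lam (k - 1) *\<^sub>R F (z (k - 1))"]
    unfolding z_Suc[OF k1(2), symmetric] k1(3) by (simp add: diff_diff_eq2 diff_add_eq)
  then have "\<phi> * ((z k - zbar k) \<bullet> (z (k + 1) - z k))
        + lam (k - 1) * (F (z (k - 1)) \<bullet> (z (k + 1) - z k))
      \<ge> lam (k - 1) * (?G (z k) - ?G (z (k + 1)))"
    unfolding z_minus_zbar[OF k1(1)] by (simp add: inner_add_left)
  \<comment> \<open>Rescaling to the current step size lets the \<open>g\<close> and
    \<open>F\<close> terms match those of the first inequality and produces the factor
    \<open>\<theta> k\<close>.\<close>
  then have "lam k / lam (k - 1) * (\<phi> * ((z k - zbar k) \<bullet> (z (k + 1) - z k))
        + lam (k - 1) * (F (z (k - 1)) \<bullet> (z (k + 1) - z k)))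
      \<ge> lam k / lam (k - 1) * (lam (k - 1) * (?G (z k) - ?G (z (k + 1))))"
    using lam_pos[of k] lam_pos[of "k - 1"] by (intro mult_left_mono) auto
  then have 2: "\<theta> k * ((z k - zbar k) \<bullet> (z (k + 1) - z k))
        + lam k * (F (z (k - 1)) \<bullet> (z (k + 1) - z k))
      \<ge> lam k * (?G (z k) - ?G (z (k + 1)))"
    using lam_pos[of "k - 1"] by (simp add: theta_eq[OF k1(1)] distrib_left mult_ac)
  have "?G s - ?G (z k) \<le> F s \<bullet> (z k - s)" by (rule VI_solutionD[OF proper s z_dom])
  also have "F s \<bullet> (z k - s) \<le> F (z k) \<bullet> (z k - s)"
    using mono z_dom[of k] s_dom by (auto simp: monotone_operator_on_def inner_diff_left)
  finally have 3: "lam k * (?G s - ?G (z k)) \<le> lam k * (F (z k) \<bullet> (z k - s))"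
    using lam_pos[of k] by simp
  have "lam k * ((F (z k) - F (z (k - 1))) \<bullet> (z k - z (k + 1)))
    = lam k * (F (z k) \<bullet> (s - z (k + 1))) + lam k * (F (z k) \<bullet> (z k - s))
      + lam k * (F (z (k - 1)) \<bullet> (z (k + 1) - z k))"
    by (simp add: inner_simps algebra_simps)
  then show "(z (k + 1) - zbar k) \<bullet> (s - z (k + 1)) + \<theta> k * ((z k - zbar k) \<bullet> (z (k + 1) - z k))
      + lam k * ((F (z k) - F (z (k - 1))) \<bullet> (z k - z (k + 1))) \<ge> 0"
    using 1 2 3 by (simp add: right_diff_distrib)
  show "\<phi> *\<^sub>R zbar (k + 1) = (\<phi> - 1) *\<^sub>R z (k + 1) + zbar k"
    using zbar_scaled[of "k + 1"] by simp
qed (use phi1 theta_le step_lipschitz lam_pos theta_pos delta0 k in \<open>auto simp: less_imp_le\<close>)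

text \<open>Up to constants, the decrease of the Lyapunov function in one step, and at the same time
  a bound on the squared residual.\<close>

definition "gap k = (norm (z (k + 1) - z k))\<^sup>2 + (norm (z k - zbar k))\<^sup>2"

lemma theta_lower_bound: "\<exists>t>0. \<forall>k\<ge>2. t \<le> \<theta> k"
proof -
  obtain m where m: "m > 0" "\<And>k. k \<ge> 2 \<Longrightarrow> m \<le> lam k" using lam_lower_bound by blast
  have "\<phi> * (m / lam_max) \<le> \<theta> k" if "k \<ge> 2" for k
  proof -
    have "m / lam_max \<le> lam k / lam (k - 1)"
      using m(1) m(2)[OF that] lam_le(2)[of "k - 1"] lam_pos[of "k - 1"] that
      by (intro frac_le) auto
    then show ?thesis using theta_eq[of k] that phi1 by (simp del: times_divide_eq_right)
  qed
  moreover have "\<phi> * (m / lam_max) > 0" using m lam_max phi1 by simp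
  ultimately show ?thesis by blast
qed

text \<open>With weight \<open>\<delta>\<close> on its second term the Lyapunov function
  \<open>D\<close> drops by a multiple of \<open>gap k\<close> at each step; being nonnegative it
  converges, so its decrements vanish.\<close>

lemma gap_tendsto_0:
  assumes s: "s \<in> VI_solutions g F"
  shows "gap \<longlonglongrightarrow> 0"
proof -
  obtain t where t: "t > 0" "\<And>k. k \<ge> 2 \<Longrightarrow> t \<le> \<theta> k" using theta_lower_bound by blast
  define D where "D k = \<phi> / (\<phi> - 1) * (norm (zbar k - s))\<^sup>2
      + \<delta> * (\<theta> (k - 1) / 2 * (norm (z k - z (k - 1)))\<^sup>2)" for k
  \<comment> \<open>Small enough for both parts of the gap: below
    \<open>(1 - \<delta>) * \<theta> k / 2\<close> for the increment and below
    \<open>\<theta> k\<close> for the distance to the average.\<close>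
  define \<kappa> where "\<kappa> = (1 - \<delta>) * t / 2"
  have kap: "\<kappa> > 0" using t delta1 by (simp add: \<kappa>_def)
  have D0: "D k \<ge> 0" for k
    using phi1 delta0 theta_pos[of "k - 1"] by (simp add: D_def)
  have desc: "D (k + 1) + \<kappa> * gap k \<le> D k" if k: "k \<ge> 2" for k
  proof -
    have "\<kappa> \<le> (1 - \<delta>) * (\<theta> k / 2)"
      using t(2)[OF k] delta1 by (simp add: \<kappa>_def)
    then have "\<kappa> * (norm (z (k + 1) - z k))\<^sup>2 \<le> (1 - \<delta>) * (\<theta> k / 2) * (norm (z (k + 1) - z k))\<^sup>2"
      by (rule mult_right_mono) simp
    moreover have "(1 - \<delta>) * t \<le> 1 * t" using t(1) delta0 by (intro mult_right_mono) auto
    then have "\<kappa> \<le> \<theta> k" unfolding \<kappa>_def using t(1) t(2)[OF k] by linarith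
    then have "\<kappa> * (norm (z k - zbar k))\<^sup>2 \<le> \<theta> k * (norm (z k - zbar k))\<^sup>2"
      by (rule mult_right_mono) simp
    ultimately show ?thesis
      using lyapunov_step[OF k s] by (simp add: D_def gap_def algebra_simps)
  qed
  have gap0: "gap k \<ge> 0" for k by (simp add: gap_def)
  have "decseq (\<lambda>k. D (k + 2))"
  proof (rule decseq_SucI)
    show "D (Suc k + 2) \<le> D (k + 2)" for k
      using desc[of "k + 2"] mult_nonneg_nonneg[OF less_imp_le[OF kap] gap0[of "k + 2"]] by simp
  qed
  then obtain d where "(\<lambda>k. D (k + 2)) \<longlonglongrightarrow> d"
    using decseq_convergent[of _ 0] D0 by blast
  then have D: "D \<longlonglongrightarrow> d" by (rule LIMSEQ_offset)
  have "(\<lambda>k. (D k - D (k + 1)) / \<kappa>) \<longlonglongrightarrow> (d - d) / \<kappa>"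
    using kap by (intro tendsto_intros D LIMSEQ_ignore_initial_segment) auto
  then have lim: "(\<lambda>k. (D k - D (k + 1)) / \<kappa>) \<longlonglongrightarrow> 0" by simp
  show ?thesis
  proof (rule tendsto_sandwich[OF _ _ tendsto_const lim])
    show "\<forall>\<^sub>F k in sequentially. 0 \<le> gap k" using gap0 by simp
    show "\<forall>\<^sub>F k in sequentially. gap k \<le> (D k - D (k + 1)) / \<kappa>"
      using eventually_ge_at_top[of 2]
      by eventually_elim (use desc kap in \<open>force simp: field_simps\<close>)
  qed
qed

section \<open>The error bound and the linear rate\<close>

text \<open>Apply \<open>norm_residual_le\<close> to the prox step from \<open>zbar k\<close> to
  \<open>z (k + 1)\<close>; the lower bound on \<open>lam k\<close> makes its coefficient uniform in
  \<open>k\<close>.\<close>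

lemma residual_le_gap:
  assumes "\<tau> > 0"
  shows "\<exists>C>0. \<forall>k\<ge>2. (norm (residual g F (z k) \<tau>))\<^sup>2 \<le> C * gap k"
proof -
  obtain m where m: "m > 0" "\<And>k. k \<ge> 2 \<Longrightarrow> m \<le> lam k" using lam_lower_bound by blast
  define B where "B = 2 + \<tau> / m"
  have B: "B > 0" using assms m by (simp add: B_def add_pos_pos)
  have "(norm (residual g F (z k) \<tau>))\<^sup>2 \<le> 2 * B\<^sup>2 * gap k" if k: "k \<ge> 2" for k
  proof -
    define a where "a = norm (z (k + 1) - z k)"
    define b where "b = norm (z k - zbar k)"
    have ab: "a \<ge> 0" "b \<ge> 0" by (auto simp: a_def b_def)
    have zk: "prox (lam k) g (zbar k - lam k *\<^sub>R F (z k)) = z (k + 1)" using z_Suc[of k] k by simp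
    have "norm (residual g F (z k) \<tau>) \<le> 2 * a + \<tau> / lam k * norm (z (k + 1) - zbar k)"
      using norm_residual_le[OF proper conv lsc assms lam_pos[of k], of F "z k" "zbar k"]
      unfolding zk a_def .
    also have "\<dots> \<le> 2 * a + \<tau> / m * (a + b)"
    proof -
      have "norm (z (k + 1) - zbar k) \<le> a + b"
        using norm_triangle_ineq[of "z (k + 1) - z k" "z k - zbar k"] by (simp add: a_def b_def)
      moreover have "\<tau> / lam k \<le> \<tau> / m" using m(1) m(2)[OF k] assms by (simp add: frac_le)
      ultimately show ?thesis
        using assms m(1) by (intro add_left_mono mult_mono) auto
    qed
    also have "\<dots> \<le> B * (a + b)" using ab by (simp add: B_def algebra_simps)
    finally have "(norm (residual g F (z k) \<tau>))\<^sup>2 \<le> (B * (a + b))\<^sup>2" by (rule power_mono) simp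
    also have "\<dots> \<le> B\<^sup>2 * (2 * (a\<^sup>2 + b\<^sup>2))"
      using zero_le_power2[of "a - b"] unfolding power_mult_distrib
      by (intro mult_left_mono) (auto simp: power2_eq_square algebra_simps)
    finally show ?thesis by (simp add: gap_def a_def b_def distrib_left)
  qed
  moreover have "2 * B\<^sup>2 > 0" using B by simp
  ultimately show ?thesis by blast
qed

text \<open>The gap, and with it the residual, tends to zero, so the error bound eventually applies
  to \<open>z k\<close>; \<open>zbar k\<close> differs from \<open>z k\<close> by a term of the
  gap.\<close>

lemma infdist_le_gap:
  assumes "VI_solutions g F \<noteq> {}" "\<tau> > 0" "error_bound g F \<tau>"
  shows "\<exists>M>0. \<exists>K\<ge>2. \<forall>k\<ge>K. (infdist (z k) (VI_solutions g F))\<^sup>2 \<le> M * gap k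
    \<and> (infdist (zbar k) (VI_solutions g F))\<^sup>2 \<le> M * gap k"
proof -
  let ?S = "VI_solutions g F"
  obtain C where C: "C > 0" "\<And>k. k \<ge> 2 \<Longrightarrow> (norm (residual g F (z k) \<tau>))\<^sup>2 \<le> C * gap k"
    using residual_le_gap[OF assms(2)] by blast
  obtain \<mu> \<eta> where eb: "\<mu> > 0" "\<eta> > 0"
    "\<And>x. x \<in> effdom g \<Longrightarrow> norm (residual g F x \<tau>) \<le> \<eta> \<Longrightarrow>
      infdist x ?S \<le> \<mu> * norm (residual g F x \<tau>)"
    using assms(3) unfolding error_bound_def by blast
  obtain s where "s \<in> ?S" using assms(1) by blast
  then have "(\<lambda>k. C * gap k) \<longlonglongrightarrow> 0" using tendsto_mult_right_zero gap_tendsto_0 by blast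
  then have "\<forall>\<^sub>F k in sequentially. C * gap k < \<eta>\<^sup>2"
    by (rule order_tendstoD(2)) (use eb in simp)
  then obtain K where K: "\<And>k. k \<ge> K \<Longrightarrow> C * gap k < \<eta>\<^sup>2"
    by (auto simp: eventually_at_top_linorder)
  define M where "M = 2 * (\<mu>\<^sup>2 * C + 1)"
  have M: "M > 0" "\<mu>\<^sup>2 * C \<le> M" using C(1) by (auto simp: M_def add_nonneg_pos)
  have "(infdist (z k) ?S)\<^sup>2 \<le> M * gap k \<and> (infdist (zbar k) ?S)\<^sup>2 \<le> M * gap k"
    if k: "k \<ge> max 2 K" for k
  proof -
    have gap0: "gap k \<ge> 0" by (simp add: gap_def)
    have r: "(norm (residual g F (z k) \<tau>))\<^sup>2 \<le> C * gap k" using C(2) k by simp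
    also have "\<dots> \<le> \<eta>\<^sup>2" using K[of k] k by simp
    finally have "norm (residual g F (z k) \<tau>) \<le> \<eta>"
      using eb(2) power2_le_imp_le by (meson less_imp_le)
    then have "(infdist (z k) ?S)\<^sup>2 \<le> (\<mu> * norm (residual g F (z k) \<tau>))\<^sup>2"
      using eb(3)[OF z_dom] by (intro power_mono infdist_nonneg)
    also have "\<dots> \<le> \<mu>\<^sup>2 * (C * gap k)"
      unfolding power_mult_distrib using r by (intro mult_left_mono) auto
    finally have z: "(infdist (z k) ?S)\<^sup>2 \<le> \<mu>\<^sup>2 * C * gap k" by simp
    have "(infdist (zbar k) ?S)\<^sup>2 \<le> (infdist (z k) ?S + norm (z k - zbar k))\<^sup>2"
      using infdist_triangle[of "zbar k" ?S "z k"]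
      by (intro power_mono infdist_nonneg) (auto simp: dist_norm norm_minus_commute)
    also have "\<dots> \<le> 2 * ((infdist (z k) ?S)\<^sup>2 + (norm (z k - zbar k))\<^sup>2)"
      using zero_le_power2[of "infdist (z k) ?S - norm (z k - zbar k)"]
      by (simp add: power2_eq_square algebra_simps)
    also have "\<dots> \<le> 2 * (\<mu>\<^sup>2 * C * gap k + gap k)"
      by (intro mult_left_mono add_mono z) (auto simp: gap_def)
    also have "\<dots> = M * gap k" by (simp add: M_def algebra_simps)
    finally show ?thesis using z mult_right_mono[OF M(2) gap0] by linarith
  qed
  with M(1) show ?thesis by (metis max.cobounded1)
qed

lemma R_linear_convergence:
  assumes S: "VI_solutions g F \<noteq> {}" and "\<tau> > 0" "error_bound g F \<tau>"
  shows "\<exists>s\<in>VI_solutions g F. converges_R_linearly z s"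
proof -
  let ?S = "VI_solutions g F"
  have closed_S: "closed ?S"
    using closed_VI_solutions[OF proper lsc lips] .
  obtain t where t: "t > 0" "\<And>k. k \<ge> 2 \<Longrightarrow> t \<le> \<theta> k" using theta_lower_bound by blast
  obtain M K where M: "M > 0" and K: "K \<ge> 2"
    and z_gap: "\<And>k. k \<ge> K \<Longrightarrow> (infdist (z k) ?S)\<^sup>2 \<le> M * gap k"
    and zbar_gap: "\<And>k. k \<ge> K \<Longrightarrow> (infdist (zbar k) ?S)\<^sup>2 \<le> M * gap k"
    using infdist_le_gap[OF assms] by blast
  define c where "c = \<phi> / (\<phi> - 1)"
  define d where "d k = infdist (zbar k) ?S" for k
  define A where "A k = \<theta> (k - 1) / 2 * (norm (z k - z (k - 1)))\<^sup>2" for k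
  \<comment> \<open>Half of the surplus \<open>1 - \<delta>\<close> is spent on the distance term,
    while the other half keeps \<open>\<delta> / (1 - \<epsilon>)\<close> below 1.\<close>
  define \<epsilon> where "\<epsilon> = (1 - \<delta>) / 2"
  define \<kappa> where "\<kappa> = \<epsilon> * t / (2 * M)"
  \<comment> \<open>One contraction factor for each term of \<open>W\<close>; the second entry also
    makes \<open>q\<close> positive.\<close>
  define q where "q = max (1 - \<kappa> / c) (\<delta> / (1 - \<epsilon>))"
  define W where "W k = c * (d k)\<^sup>2 + (1 - \<epsilon>) * A k" for k
  have eps: "0 < \<epsilon>" "\<epsilon> < 1" "\<delta> < 1 - \<epsilon>"
    using delta0 delta1 by (auto simp: \<epsilon>_def field_simps)
  have c: "c > 0" using phi1 by (simp add: c_def)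
  have kap: "\<kappa> > 0" using eps t M by (simp add: \<kappa>_def)
  have q: "0 < q" "q < 1" using eps c kap delta0 by (auto simp: q_def less_max_iff_disj)
  have A0: "A k \<ge> 0" for k using theta_pos[of "k - 1"] by (simp add: A_def)
  have W0: "W k \<ge> 0" for k using c eps A0 by (simp add: W_def)
  have contract: "W (Suc k) \<le> q * W k" if k: "k \<ge> K" for k
  proof -
    have k2: "k \<ge> 2" using k K by simp
    \<comment> \<open>The nearest solution changes with \<open>k\<close>, which is harmless:
      \<open>d (Suc k)\<close> is at most the distance from the next average to this same
      \<open>s\<close>.\<close>
    obtain s where s: "s \<in> ?S" "d k = dist (zbar k) s"
      using infdist_attains_inf[OF closed_S S] unfolding d_def by blast
    have "(d (Suc k))\<^sup>2 \<le> (norm (zbar (Suc k) - s))\<^sup>2"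
      unfolding d_def using infdist_le[OF s(1)]
      by (intro power_mono infdist_nonneg) (simp add: dist_norm)
    then have "c * (d (Suc k))\<^sup>2 \<le> c * (norm (zbar (Suc k) - s))\<^sup>2" using c by simp
    then have 1: "c * (d (Suc k))\<^sup>2 + A (Suc k) + \<theta> k * (norm (z k - zbar k))\<^sup>2
        \<le> c * (d k)\<^sup>2 + \<delta> * A k"
      using lyapunov_step[OF k2 s(1)] s(2) by (simp add: A_def c_def dist_norm)
    have "\<kappa> * (d k)\<^sup>2 \<le> \<kappa> * (M * gap k)"
      using zbar_gap[OF k] kap by (simp add: d_def)
    also have "\<dots> = \<epsilon> * (t / 2) * (norm (z (k + 1) - z k))\<^sup>2 + \<epsilon> * (t / 2) * (norm (z k - zbar k))\<^sup>2"
      using M by (simp add: \<kappa>_def gap_def field_simps)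
    also have "\<dots> \<le> \<epsilon> * (\<theta> k / 2) * (norm (z (k + 1) - z k))\<^sup>2 + \<theta> k * (norm (z k - zbar k))\<^sup>2"
    proof (intro add_mono mult_right_mono)
      show "\<epsilon> * (t / 2) \<le> \<epsilon> * (\<theta> k / 2)" using t(2)[OF k2] eps by simp
      have "\<epsilon> * (t / 2) \<le> 1 * (t / 2)" using eps t by (intro mult_right_mono) auto
      then show "\<epsilon> * (t / 2) \<le> \<theta> k" using t(1) t(2)[OF k2] by linarith
    qed auto
    also have "\<dots> = \<epsilon> * A (Suc k) + \<theta> k * (norm (z k - zbar k))\<^sup>2" by (simp add: A_def)
    finally have "W (Suc k) \<le> (c - \<kappa>) * (d k)\<^sup>2 + \<delta> * A k"
      using 1 by (simp add: W_def algebra_simps)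
    also have "\<dots> \<le> (q * c) * (d k)\<^sup>2 + (q * (1 - \<epsilon>)) * A k"
    proof (intro add_mono mult_right_mono)
      have "(1 - \<kappa> / c) * c \<le> q * c" using c by (intro mult_right_mono) (auto simp: q_def)
      then show "c - \<kappa> \<le> q * c" using c by (simp add: left_diff_distrib)
      have "\<delta> / (1 - \<epsilon>) * (1 - \<epsilon>) \<le> q * (1 - \<epsilon>)"
        using eps by (intro mult_right_mono) (auto simp: q_def)
      then show "\<delta> \<le> q * (1 - \<epsilon>)" using eps by simp
    qed (use A0 in auto)
    also have "\<dots> = q * W k" by (simp add: W_def algebra_simps)
    finally show ?thesis .
  qed
  define B where "B = W K / q ^ K"
  have W_geo: "W k \<le> B * q ^ k" if "k \<ge> K" for k
    using that
  proof (induction k rule: dec_induct)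
    case base
    then show ?case using q by (simp add: B_def)
  next
    case (step n)
    have "W (Suc n) \<le> q * W n" using contract step by simp
    also have "\<dots> \<le> q * (B * q ^ n)" using step q by simp
    finally show ?case by (simp add: mult_ac)
  qed
  \<comment> \<open>The summand 1 keeps \<open>C\<close> positive when \<open>B = 0\<close>.\<close>
  define C where "C = 2 * B / (t * (1 - \<epsilon>)) + 1"
  have "B \<ge> 0" using W0 q by (simp add: B_def)
  then have C: "C > 0" using t eps by (simp add: C_def add_nonneg_pos)
  \<comment> \<open>The second term of \<open>W\<close> controls squared increments, so the
    increments themselves decay at the rate \<open>sqrt q\<close>.\<close>
  have "norm (z (k + 1) - z k) \<le> sqrt C * sqrt q ^ k" if k: "k \<ge> K" for k
  proof -
    have "t / 2 * (norm (z (k + 1) - z k))\<^sup>2 \<le> A (k + 1)"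
      using t(2)[of k] k K by (simp add: A_def mult_right_mono)
    then have "(1 - \<epsilon>) * (t / 2 * (norm (z (k + 1) - z k))\<^sup>2) \<le> (1 - \<epsilon>) * A (k + 1)"
      using eps by simp
    also have "\<dots> \<le> W (k + 1)" using c by (simp add: W_def)
    also have "\<dots> \<le> B * q ^ (k + 1)" using W_geo[of "k + 1"] k by simp
    also have "\<dots> \<le> B * q ^ k"
      using \<open>B \<ge> 0\<close> q by (intro mult_left_mono power_decreasing) auto
    finally have "(norm (z (k + 1) - z k))\<^sup>2 \<le> 2 * B / (t * (1 - \<epsilon>)) * q ^ k"
      using t eps by (simp add: field_simps)
    also have "\<dots> \<le> C * q ^ k" using q by (intro mult_right_mono) (auto simp: C_def)
    finally show ?thesis
      by (metis real_le_rsqrt real_sqrt_mult real_sqrt_power)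
  qed
  moreover have "0 < sqrt q" "sqrt q < 1" "sqrt C > 0" using q C by auto
  ultimately obtain l where l: "converges_R_linearly z l"
    using R_linear_of_geometric_increments[of "sqrt q" "sqrt C" K z] by blast
  \<comment> \<open>The limit \<open>l\<close> is not yet known to be a solution: its distance to
    the closed set of solutions vanishes because the gap does.\<close>
  have "(\<lambda>k. (infdist (z k) ?S)\<^sup>2) \<longlonglongrightarrow> (infdist l ?S)\<^sup>2"
    using l by (intro tendsto_intros) (simp add: converges_R_linearly_def)
  moreover have "(\<lambda>k. (infdist (z k) ?S)\<^sup>2) \<longlonglongrightarrow> 0"
  proof (rule tendsto_sandwich[OF _ _ tendsto_const])
    show "(\<lambda>k. M * gap k) \<longlonglongrightarrow> 0"
      using S tendsto_mult_right_zero gap_tendsto_0 by blast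
    show "\<forall>\<^sub>F k in sequentially. (infdist (z k) ?S)\<^sup>2 \<le> M * gap k"
      using z_gap by (auto simp: eventually_at_top_linorder)
  qed simp
  ultimately have "(infdist l ?S)\<^sup>2 = 0" by (rule LIMSEQ_unique)
  then have "l \<in> ?S" using in_closed_iff_infdist_zero[OF closed_S S] by simp
  then show ?thesis using l by blast
qed

end

theorem theorem3:
  fixes g :: "'a::euclidean_space \<Rightarrow> ereal" and F :: "'a \<Rightarrow> 'a"
    and L \<tau> \<phi> \<delta> lam_max :: real
    and z zbar :: "nat \<Rightarrow> 'a" and lam \<theta> :: "nat \<Rightarrow> real"
  assumes "proper_fun g" and "convex_fun g" and "lsc_fun g"
    and "monotone_operator_on (effdom g) F"
    and "L-lipschitz_on (effdom g) F"
    and "VI_solutions g F \<noteq> {}"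
    and "\<tau> > 0" and "error_bound g F \<tau>"
    and "1 < \<phi>" and "\<phi> \<le> golden_ratio"
    and "lam_max > 0"
    and "0 < \<delta>" and "\<delta> < 1"
    and "adaptive_graal g F \<phi> \<delta> lam_max z zbar lam \<theta>"
  shows "\<exists>zs \<in> VI_solutions g F. converges_R_linearly z zs"
proof -
  interpret graal g F L \<phi> \<delta> lam_max z zbar lam \<theta>
    by unfold_locales (use assms in auto)
  show ?thesis by (rule R_linear_convergence) (use assms in auto)
qed

end
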